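(* Let $d\ge2$ and let $F\subset\mathbb{R}^d$ be a fractal necklace with a necklace iterated function system $\{f_1,\dots,f_n\}$. If $F$ is stable and of bounded ramification, then $F$ has no cut points.
   Context: Let $d\ge2$ and $I=\{1,2,\dots,n\}$. For $k\in I$ let $f_k:\mathbb{R}^d\to\mathbb{R}^d$ be contractive, i.e. $|f_k(x)-f_k(y)|\le c_k|x-y|$ for all $x,y$, with some $c_k\in(0,1)$. The attractor of the iterated function system (IFS) $\{f_1,\dots,f_n\}$ is the unique nonempty compact set $F\subset\mathbb{R}^d$ with $F=\bigcup_{k=1}^n f_k(F)$. Fractal necklace: $F$ is called a (fractal) necklace, and the ordered family $\{f_1,\dots,f_n\}$ a necklace IFS, if $n\ge3$, every $f_k$ is a contractive homeomorphism of $\mathbb{R}^d$ onto itself, and for each pair of distinct $m,k\in I$: $f_m(F)\cap f_k(F)$ is a singleton if $|m-k|=1$ or $|m-k|=n-1$, and $f_m(F)\cap f_k(F)=\emptyset$ if $2\le|m-k|\le n-2$. Notation: for a word $\sigma=i_1\cdots i_m\in I^m$ ($m\ge0$), $f_\sigma=f_{i_1}\circ\cdots\circ f_{i_m}$ (with $f_\emptyset=\mathrm{id}$) and $F_\sigma=f_\sigma(F)$; the sets $F_\sigma$, $\sigma\in I^m$, are the $m$-level copies of $F$. For $k\in I$ let $z_k$ be the unique point of $F_k\cap F_{k+1}$, where $F_{n+1}:=F_1$; the points $z_1,\dots,z_n$ are the main nodes of $F$. For $A\subset F$, $\partial_F A$ is the boundary of $A$ in the relative topology of $F$. Stable: $F$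 is stable if for each $k\in I$ the set of sets $\{F_{kj}: j\in I,\ F_{kj}\cap\partial_F F_k\ne\emptyset\}$ has at least $2$ elements. Bounded ramification: for $z\in F$ and $m\ge0$ let $c_m(z)$ be the number of $m$-level copies of $F$ containing $z$. $F$ is of bounded ramification if the sequence $\{c_m(z_k)\}_{m=1}^\infty$ is bounded for each $k\in I$. Cut point: a point $x$ of a connected topological space $X$ is a cut point of $X$ if $X\setminus\{x\}$ is not connected. (Every fractal necklace is connected.) *)

theory Defs
  imports "HOL-Analysis.Analysis"
begin

text \<open>
  Iterated function systems are families \<open>f 1, \<dots>, f n\<close>, given by a function on \<open>nat\<close> of which
  only the values on \<open>{1..n}\<close> matter.
\<close>

definition contractive :: "('a::metric_space \<Rightarrow> 'a) \<Rightarrow> bool" where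
  "contractive g \<longleftrightarrow> (\<exists>c. 0 < c \<and> c < 1 \<and> c-lipschitz_on UNIV g)"

text \<open>
  For contractive \<open>f k\<close> on a complete space with \<open>1 \<le> n\<close>, exactly one set satisfies the following
  predicate (Hutchinson), so it determines \<open>F\<close>.
\<close>

definition is_attractor :: "nat \<Rightarrow> (nat \<Rightarrow> 'a::metric_space \<Rightarrow> 'a) \<Rightarrow> 'a set \<Rightarrow> bool" where
  "is_attractor n f F \<longleftrightarrow> F \<noteq> {} \<and> compact F \<and> F = (\<Union>k\<in>{1..n}. f k ` F)"

definition word_map :: "(nat \<Rightarrow> 'a \<Rightarrow> 'a) \<Rightarrow> nat list \<Rightarrow> 'a \<Rightarrow> 'a" where
  "word_map f \<sigma> = foldr (\<circ>) (map f \<sigma>) id"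

lemma word_map_Nil: "word_map f [] = id"
  and word_map_Cons: "word_map f (i # \<sigma>) = f i \<circ> word_map f \<sigma>"
  by (simp_all add: word_map_def)

definition copy :: "(nat \<Rightarrow> 'a \<Rightarrow> 'a) \<Rightarrow> 'a set \<Rightarrow> nat list \<Rightarrow> 'a set" where
  "copy f F \<sigma> = word_map f \<sigma> ` F"

definition level_copies :: "nat \<Rightarrow> (nat \<Rightarrow> 'a \<Rightarrow> 'a) \<Rightarrow> 'a set \<Rightarrow> nat \<Rightarrow> 'a set set" where
  "level_copies n f F m = copy f F ` {\<sigma>. set \<sigma> \<subseteq> {1..n} \<and> length \<sigma> = m}"

text \<open>Index differences are taken in \<open>int\<close>, since subtraction on \<open>nat\<close> truncates.\<close>

definition necklace_IFS :: "nat \<Rightarrow> (nat \<Rightarrow> 'a::metric_space \<Rightarrow> 'a) \<Rightarrow> 'a set \<Rightarrow> bool" where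
  "necklace_IFS n f F \<longleftrightarrow>
     3 \<le> n \<and>
     (\<forall>k\<in>{1..n}. contractive (f k) \<and> (\<exists>g. homeomorphism UNIV UNIV (f k) g)) \<and>
     is_attractor n f F \<and>
     (\<forall>m\<in>{1..n}. \<forall>k\<in>{1..n}. m \<noteq> k \<longrightarrow>
        (\<bar>int m - int k\<bar> = 1 \<or> \<bar>int m - int k\<bar> = int n - 1
           \<longrightarrow> is_singleton (f m ` F \<inter> f k ` F)) \<and>
        (2 \<le> \<bar>int m - int k\<bar> \<and> \<bar>int m - int k\<bar> \<le> int n - 2
           \<longrightarrow> f m ` F \<inter> f k ` F = {}))"

definition main_node :: "nat \<Rightarrow> (nat \<Rightarrow> 'a \<Rightarrow> 'a) \<Rightarrow> 'a set \<Rightarrow> nat \<Rightarrow> 'a" where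
  "main_node n f F k =
     the_elem (copy f F [k] \<inter> copy f F [if k = n then 1 else k + 1])"

text \<open>
  In the next two definitions the copies are counted as sets, not as words. The frontier is the
  one relative to \<open>F\<close>.
\<close>

definition stable_necklace :: "nat \<Rightarrow> (nat \<Rightarrow> 'a::topological_space \<Rightarrow> 'a) \<Rightarrow> 'a set \<Rightarrow> bool" where
  "stable_necklace n f F \<longleftrightarrow>
     (\<forall>k\<in>{1..n}.
        2 \<le> card {copy f F [k, j] | j. j \<in> {1..n} \<and>
               copy f F [k, j] \<inter> (top_of_set F frontier_of copy f F [k]) \<noteq> {}})"

definition num_copies_at :: "nat \<Rightarrow> (nat \<Rightarrow> 'a \<Rightarrow> 'a) \<Rightarrow> 'a set \<Rightarrow> nat \<Rightarrow> 'a \<Rightarrow> nat" where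
  "num_copies_at n f F m z = card {C \<in> level_copies n f F m. z \<in> C}"

definition bounded_ramification :: "nat \<Rightarrow> (nat \<Rightarrow> 'a \<Rightarrow> 'a) \<Rightarrow> 'a set \<Rightarrow> bool" where
  "bounded_ramification n f F \<longleftrightarrow>
     (\<forall>k\<in>{1..n}. \<exists>B. \<forall>m\<ge>1. num_copies_at n f F m (main_node n f F k) \<le> B)"

text \<open>
  Cut points are meant for connected \<open>X\<close>. Connectedness of \<open>X\<close> is deliberately not a conjunct:
  then the absence of cut points does not hold vacuously for disconnected \<open>X\<close>.
\<close>

definition cut_point :: "'a::topological_space set \<Rightarrow> 'a \<Rightarrow> bool" where
  "cut_point X x \<longleftrightarrow> x \<in> X \<and> \<not> connected (X - {x})"

end

theory Submission
  imports Defs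
begin

text \<open>
  Call a point a node if it lies in two different cells \<open>f k ` F\<close>. The argument transports a
  disconnection of \<open>F\<close> minus a point from large scale to small scale.

  Suppose \<open>F - {x}\<close> is separated into \<open>U\<close> and \<open>V\<close>. If \<open>x\<close> lies in the single cell \<open>l\<close>, the other
  cells form a connected chain and lie on one side, say in \<open>U\<close>; if \<open>x\<close> is a node, common to the
  cells \<open>i\<close> and \<open>j\<close> only, the same holds for the cells other than these two. In both cases the
  other side is squeezed into cells that contain \<open>x\<close>, and pulling \<open>U\<close> and \<open>V\<close> back by the map of
  one such cell separates \<open>F - {x'}\<close>, where \<open>x'\<close> is the preimage of \<open>x\<close>
  (\<open>non_node_step\<close>, \<open>node_step\<close>). So every cut point is the image of another cut point.

  Stability decides which side is squeezed. The boundary points of a cell that differ from \<open>x\<close> lie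
  in \<open>U\<close>, and their preimages meet two different cells of \<open>F\<close>. When \<open>x'\<close> is not a node, it misses
  one of these two cells, so a cell avoiding \<open>x'\<close> meets the pulled back \<open>U\<close>; hence at the next scale
  it is again \<open>V\<close> that is squeezed. If no node is met along the way, \<open>V\<close> lies in copies of \<open>F\<close>
  of all levels around \<open>x\<close>, whose diameters tend to \<open>0\<close>, so \<open>V\<close> contains no point other than
  \<open>x\<close>: a contradiction (\<open>no_persistent_non_node_cut\<close>).

  Bounded ramification ensures that nodes stop occurring. The number of copies through a point does
  not grow on passing to a preimage, and it drops strictly if the point is a node, because a copy
  inside the second cell is lost. Starting from a node that is a cut point and has the least bound
  on its number of copies, no further cut point obtained by pulling back is a node.
\<close>

section \<open>Separations and chains of connected sets\<close>

text \<open>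
  The two sides are open in the whole space rather than relatively open in \<open>S\<close>: preimages of \<open>U\<close> and
  \<open>V\<close> under a continuous map are then of the same form, without reference to subspaces.
\<close>

definition separation :: "'a::topological_space set \<Rightarrow> 'a set \<Rightarrow> 'a set \<Rightarrow> bool" where
  "separation S U V \<longleftrightarrow>
     open U \<and> open V \<and> S \<subseteq> U \<union> V \<and> U \<inter> V \<inter> S = {} \<and> U \<inter> S \<noteq> {} \<and> V \<inter> S \<noteq> {}"

lemma not_connected_iff_separation: "\<not> connected S \<longleftrightarrow> (\<exists>U V. separation S U V)"
  unfolding connected_def separation_def by blast

lemma separation_commute: "separation S U V \<Longrightarrow> separation S V U"
  unfolding separation_def by blast

lemma cut_point_if_separation: "x \<in> X \<Longrightarrow> separation (X - {x}) U V \<Longrightarrow> cut_point X x"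
  unfolding cut_point_def not_connected_iff_separation by blast

lemma connected_within_separation:
  assumes "separation S U V" "connected R" "R \<subseteq> S" "R \<inter> U \<noteq> {}"
  shows "R \<subseteq> U" "R \<inter> V = {}"
proof -
  show disjoint: "R \<inter> V = {}"
  proof (rule ccontr)
    assume "R \<inter> V \<noteq> {}"
    moreover have "R \<subseteq> U \<union> V" "U \<inter> V \<inter> R = {}"
      using assms(1,3) unfolding separation_def by auto
    ultimately have "separation R U V"
      using assms(1,4) unfolding separation_def by (simp add: Int_commute)
    then show False using assms(2) not_connected_iff_separation by blast
  qed
  have "R \<subseteq> U \<union> V" using assms(1,3) unfolding separation_def by auto
  then show "R \<subseteq> U" using disjoint by auto
qed

lemma separation_vimage:
  assumes "separation T U V" "continuous_on UNIV g" "g ` S \<subseteq> T"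
    and "g ` S \<inter> U \<noteq> {}" "g ` S \<inter> V \<noteq> {}"
  shows "separation S (g -` U) (g -` V)"
proof -
  have "open (g -` U)" "open (g -` V)"
    using assms(1,2) unfolding separation_def by (auto intro: open_vimage)
  moreover have "S \<subseteq> g -` U \<union> g -` V" "g -` U \<inter> g -` V \<inter> S = {}"
    using assms(1,3) unfolding separation_def by blast+
  moreover have "g -` U \<inter> S \<noteq> {}" "g -` V \<inter> S \<noteq> {}"
    using assms(4,5) by blast+
  ultimately show ?thesis unfolding separation_def by blast
qed

lemma connected_interval_chain:
  fixes C :: "nat \<Rightarrow> 'a::topological_space set"
  assumes "\<And>k. k \<in> {a..b} \<Longrightarrow> connected (C k)"
    and "\<And>k. a \<le> k \<Longrightarrow> k < b \<Longrightarrow> C k \<inter> C (Suc k) \<noteq> {}"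
  shows "connected (\<Union>k\<in>{a..b}. C k)"
  using assms
proof (induction b)
  case 0
  then show ?case by (cases "a = 0") auto
next
  case (Suc b)
  show ?case
  proof (cases "a \<le> b")
    case True
    have "connected ((\<Union>k\<in>{a..b}. C k) \<union> C (Suc b))"
    proof (rule connected_Un)
      show "connected (\<Union>k\<in>{a..b}. C k)" using Suc by auto
      show "connected (C (Suc b))" using Suc.prems(1) True by auto
      show "(\<Union>k\<in>{a..b}. C k) \<inter> C (Suc b) \<noteq> {}"
        using Suc.prems(2)[of b] True by fastforce
    qed
    moreover have "{a..Suc b} = insert (Suc b) {a..b}" using True by auto
    ultimately show ?thesis by (simp add: Un_commute)
  next
    case False
    then have "a = Suc b \<or> {a..Suc b} = {}" by auto
    then show ?thesis using Suc.prems(1) by (elim disjE) auto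
  qed
qed

lemma contraction_powers_vanish:
  assumes "0 < c" "c < 1" "\<And>m. (r::real) \<le> c ^ m * D"
  shows "r \<le> 0"
proof -
  have "(\<lambda>m. c ^ m * D) \<longlonglongrightarrow> 0 * D"
    by (intro tendsto_mult_right LIMSEQ_power_zero) (use assms in auto)
  then show ?thesis using assms(3) by (intro LIMSEQ_le_const) auto
qed

section \<open>Cells and nodes of a necklace\<close>

locale fractal_necklace =
  fixes n :: nat and f :: "nat \<Rightarrow> 'a::metric_space \<Rightarrow> 'a" and F :: "'a set"
  assumes necklace_IFS: "necklace_IFS n f F"
begin

abbreviation cell :: "nat \<Rightarrow> 'a set" where
  "cell k \<equiv> f k ` F"

definition adjacent :: "nat \<Rightarrow> nat \<Rightarrow> bool" where
  "adjacent i j \<longleftrightarrow> \<bar>int i - int j\<bar> = 1 \<or> \<bar>int i - int j\<bar> = int n - 1"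

lemma n_ge_3: "3 \<le> n"
  and compact_F: "compact F"
  and F_nonempty: "F \<noteq> {}"
  and F_eq_cells: "F = (\<Union>k\<in>{1..n}. cell k)"
  using necklace_IFS unfolding necklace_IFS_def is_attractor_def by blast+

lemma cell_subset: "k \<in> {1..n} \<Longrightarrow> cell k \<subseteq> F"
  using F_eq_cells by blast

lemma in_some_cell: "x \<in> F \<Longrightarrow> \<exists>k\<in>{1..n}. x \<in> cell k"
  using F_eq_cells by blast

lemma inj_f: "k \<in> {1..n} \<Longrightarrow> inj (f k)"
  using necklace_IFS unfolding necklace_IFS_def homeomorphism_def
  by (metis UNIV_I inj_on_def)

lemma continuous_f: "k \<in> {1..n} \<Longrightarrow> continuous_on UNIV (f k)"
  using necklace_IFS unfolding necklace_IFS_def homeomorphism_def by blast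

lemma common_contraction:
  obtains c where "0 < c" "c < 1"
    "\<And>k x y. k \<in> {1..n} \<Longrightarrow> dist (f k x) (f k y) \<le> c * dist x y"
proof -
  have "\<forall>k\<in>{1..n}. \<exists>c. 0 < c \<and> c < 1 \<and> c-lipschitz_on UNIV (f k)"
    using necklace_IFS unfolding necklace_IFS_def contractive_def by blast
  then obtain c where c: "\<And>k. k \<in> {1..n} \<Longrightarrow> 0 < c k \<and> c k < 1 \<and> (c k)-lipschitz_on UNIV (f k)"
    by metis
  define M where "M = Max (c ` {1..n})"
  have ne: "c ` {1..n} \<noteq> {}" using n_ge_3 by auto
  have le: "c k \<le> M" if "k \<in> {1..n}" for k
    unfolding M_def using that by auto
  have "M \<in> c ` {1..n}" unfolding M_def by (rule Max_in) (use ne in auto)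
  then have "0 < M" "M < 1" using c by auto
  moreover have "dist (f k x) (f k y) \<le> M * dist x y" if "k \<in> {1..n}" for k x y
  proof -
    have "dist (f k x) (f k y) \<le> c k * dist x y"
      using c[OF that] lipschitz_onD by blast
    also have "\<dots> \<le> M * dist x y" using le[OF that] by (simp add: mult_right_mono)
    finally show ?thesis .
  qed
  ultimately show ?thesis using that by blast
qed

lemma adjacent_singleton:
  "\<lbrakk>i \<in> {1..n}; j \<in> {1..n}; i \<noteq> j; adjacent i j\<rbrakk> \<Longrightarrow> is_singleton (cell i \<inter> cell j)"
  using necklace_IFS unfolding necklace_IFS_def adjacent_def by blast

lemma meeting_cells_adjacent:
  assumes "i \<in> {1..n}" "j \<in> {1..n}" "i \<noteq> j" "cell i \<inter> cell j \<noteq> {}"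
  shows "adjacent i j"
proof (rule ccontr)
  assume "\<not> adjacent i j"
  then have "2 \<le> \<bar>int i - int j\<bar> \<and> \<bar>int i - int j\<bar> \<le> int n - 2"
    using assms(1-3) unfolding adjacent_def by auto
  then show False using necklace_IFS assms unfolding necklace_IFS_def by blast
qed

lemma meeting_point_unique:
  assumes "i \<in> {1..n}" "j \<in> {1..n}" "i \<noteq> j" "x \<in> cell i" "x \<in> cell j" "y \<in> cell i" "y \<in> cell j"
  shows "x = y"
proof -
  have "is_singleton (cell i \<inter> cell j)"
    using assms meeting_cells_adjacent adjacent_singleton by blast
  then obtain w where "cell i \<inter> cell j = {w}" unfolding is_singleton_def by blast
  then have "x = w" "y = w" using assms by blast+
  then show ?thesis by simp
qed

lemma adjacent_meet:
  "\<lbrakk>i \<in> {1..n}; j \<in> {1..n}; i \<noteq> j; adjacent i j\<rbrakk> \<Longrightarrow> cell i \<inter> cell j \<noteq> {}"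
  using adjacent_singleton unfolding is_singleton_def by fastforce

lemma consecutive_cells_meet: "1 \<le> k \<Longrightarrow> k < n \<Longrightarrow> cell k \<inter> cell (Suc k) \<noteq> {}"
  by (rule adjacent_meet) (auto simp: adjacent_def)

lemma last_first_meet: "cell n \<inter> cell 1 \<noteq> {}"
  by (rule adjacent_meet) (use n_ge_3 in \<open>auto simp: adjacent_def\<close>)

text \<open>As \<open>3 \<le> n\<close>, the predecessor and the successor of \<open>k\<close> on the cycle are different.\<close>

lemma neighbour_avoiding:
  assumes "k \<in> {1..n}"
  obtains j where "j \<in> {1..n}" "j \<noteq> k" "j \<noteq> k'" "cell k \<inter> cell j \<noteq> {}"
proof -
  define s where "s = (if k = n then 1 else Suc k)"
  define p where "p = (if k = 1 then n else k - 1)"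
  have "s \<in> {1..n}" "s \<noteq> k" "p \<in> {1..n}" "p \<noteq> k" "s \<noteq> p"
    using assms n_ge_3 by (auto simp: s_def p_def)
  moreover have "adjacent k s" "adjacent k p"
    using assms n_ge_3 by (auto simp: s_def p_def adjacent_def)
  ultimately show ?thesis
    using that adjacent_meet assms by metis
qed

definition node :: "'a \<Rightarrow> bool" where
  "node x \<longleftrightarrow> (\<exists>i\<in>{1..n}. \<exists>j\<in>{1..n}. i \<noteq> j \<and> x \<in> cell i \<and> x \<in> cell j)"

lemma node_is_main_node:
  assumes "node x"
  obtains k where "k \<in> {1..n}" "x = main_node n f F k"
proof -
  obtain i j where ij: "i \<in> {1..n}" "j \<in> {1..n}" "i < j" "x \<in> cell i" "x \<in> cell j"
    using assms unfolding node_def by (metis nat_neq_iff)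
  have adj: "adjacent i j"
    using meeting_cells_adjacent[of i j] ij by blast
  have int1: "cell i \<inter> cell j = {x}"
    using ij meeting_point_unique[of i j] by blast
  have copies: "copy f F [k] = cell k" for k
    by (auto simp: copy_def word_map_Cons word_map_Nil)
  from adj ij have "j = i + 1 \<or> (i = 1 \<and> j = n)"
    unfolding adjacent_def by auto
  then show ?thesis
  proof
    assume "j = i + 1"
    then have "x = main_node n f F i"
      unfolding main_node_def copies using int1 ij by auto
    then show ?thesis using that ij by blast
  next
    assume "i = 1 \<and> j = n"
    then have "x = main_node n f F n"
      unfolding main_node_def copies using int1 by (simp add: Int_commute)
    moreover have "n \<in> {1..n}" using n_ge_3 by simp
    ultimately show ?thesis using that by blast
  qed
qed

section \<open>Connectedness of the necklace and of chains of cells\<close>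

text \<open>
  If \<open>U\<close> and \<open>V\<close> separate \<open>F\<close>, they separate some cell, since consecutive cells meet. Pulling back
  by the map of that cell yields another separation of \<open>F\<close>, so by induction \<open>U\<close> and \<open>V\<close> contain
  points of a common copy of \<open>F\<close> of every level and are arbitrarily close. But two disjoint
  nonempty compact sets have a positive distance.
\<close>

lemma connected_F: "connected F"
proof (rule ccontr)
  assume "\<not> connected F"
  then obtain U V where UV: "separation F U V"
    using not_connected_iff_separation by blast
  obtain c where c: "0 < c" "c < 1"
    and lip: "\<And>k x y. k \<in> {1..n} \<Longrightarrow> dist (f k x) (f k y) \<le> c * dist x y"
    using common_contraction by blast
  define D where "D = diameter F"
  have close: "\<exists>a\<in>F \<inter> U. \<exists>b\<in>F \<inter> V. dist a b \<le> c ^ m * D" if "separation F U V" for U V m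
    using that
  proof (induction m arbitrary: U V)
    case 0
    then obtain a b where "a \<in> F \<inter> U" "b \<in> F \<inter> V"
      unfolding separation_def by blast
    moreover from this have "dist a b \<le> D"
      unfolding D_def using compact_F by (simp add: diameter_bounded_bound compact_imp_bounded)
    ultimately show ?case by auto
  next
    case (Suc m)
    have "\<exists>k\<in>{1..n}. cell k \<inter> U \<noteq> {} \<and> cell k \<inter> V \<noteq> {}"
    proof (rule ccontr)
      assume none: "\<not> ?thesis"
      have one_side: "cell k \<inter> U = {} \<or> cell k \<inter> V = {}" if "k \<in> {1..n}" for k
        using none that by blast
      have cover: "cell k \<subseteq> U \<union> V" if "k \<in> {1..n}" for k
        using Suc.prems cell_subset[OF that] unfolding separation_def by blast
      have spread: "cell (Suc k) \<inter> U = {} \<longleftrightarrow> cell k \<inter> U = {}" if k: "1 \<le> k" "k < n" for k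
      proof -
        obtain y where y: "y \<in> cell k" "y \<in> cell (Suc k)"
          using consecutive_cells_meet[OF k] by blast
        have mem: "k \<in> {1..n}" "Suc k \<in> {1..n}" using k by auto
        show ?thesis
          using y one_side[OF mem(1)] one_side[OF mem(2)] cover[OF mem(1)] by blast
      qed
      have all: "cell k \<inter> U = {} \<longleftrightarrow> cell 1 \<inter> U = {}" if "1 \<le> k" "k \<le> n" for k
        using that by (induction k rule: dec_induct) (use spread in auto)
      obtain a b where "a \<in> F \<inter> U" "b \<in> F \<inter> V"
        using Suc.prems unfolding separation_def by blast
      then obtain i j where "i \<in> {1..n}" "a \<in> cell i \<inter> U" "j \<in> {1..n}" "b \<in> cell j \<inter> V"
        using in_some_cell by blast
      then show False
        using all[of i] all[of j] one_side[of j] cover[of j] by auto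
    qed
    then obtain k where k: "k \<in> {1..n}" "cell k \<inter> U \<noteq> {}" "cell k \<inter> V \<noteq> {}" by blast
    have "separation F (f k -` U) (f k -` V)"
      using separation_vimage[OF Suc.prems continuous_f[OF k(1)] cell_subset[OF k(1)]] k by blast
    then obtain a b where "a \<in> F \<inter> f k -` U" "b \<in> F \<inter> f k -` V" "dist a b \<le> c ^ m * D"
      using Suc.IH by blast
    moreover from this have "dist (f k a) (f k b) \<le> c ^ Suc m * D"
      using lip[OF k(1), of a b] c by (simp add: mult.assoc) (meson less_imp_le mult_left_mono order_trans)
    ultimately show ?case using cell_subset[OF k(1)] by blast
  qed
  have "F \<inter> U = F - V" "F \<inter> V = F - U"
    using UV unfolding separation_def by auto
  then have "compact ((F \<inter> U) \<times> (F \<inter> V))"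
    using UV compact_F unfolding separation_def by (simp add: compact_diff compact_Times)
  moreover have "(F \<inter> U) \<times> (F \<inter> V) \<noteq> {}"
    using UV unfolding separation_def by blast
  moreover have "continuous_on ((F \<inter> U) \<times> (F \<inter> V)) (\<lambda>p. dist (fst p) (snd p))"
    by (intro continuous_intros)
  ultimately obtain w where w: "w \<in> (F \<inter> U) \<times> (F \<inter> V)"
    and w_least: "\<And>p. p \<in> (F \<inter> U) \<times> (F \<inter> V) \<Longrightarrow> dist (fst w) (snd w) \<le> dist (fst p) (snd p)"
    using continuous_attains_inf[of "(F \<inter> U) \<times> (F \<inter> V)" "\<lambda>p. dist (fst p) (snd p)"] by blast
  define a0 b0 where "a0 = fst w" and "b0 = snd w"
  have ab0: "a0 \<in> F \<inter> U" "b0 \<in> F \<inter> V"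
    using w unfolding a0_def b0_def by (simp_all add: mem_Times_iff)
  have least: "dist a0 b0 \<le> dist a b" if "a \<in> F \<inter> U" "b \<in> F \<inter> V" for a b
    using w_least[of "(a, b)"] that unfolding a0_def b0_def by simp
  have "dist a0 b0 \<le> c ^ m * D" for m
    using close[OF UV, of m] least order_trans by meson
  then have "dist a0 b0 \<le> 0"
    using contraction_powers_vanish[OF c] by blast
  then show False
    using ab0 UV unfolding separation_def by auto
qed

lemma connected_cell: "k \<in> {1..n} \<Longrightarrow> connected (cell k)"
  using connected_F continuous_f connected_continuous_image continuous_on_subset by blast

lemma closed_cell: "k \<in> {1..n} \<Longrightarrow> closed (cell k)"
  using compact_F continuous_f compact_continuous_image continuous_on_subset compact_imp_closed
  by (metis subset_UNIV)

lemma connected_cell_interval: "1 \<le> a \<Longrightarrow> b \<le> n \<Longrightarrow> connected (\<Union>k\<in>{a..b}. cell k)"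
  by (rule connected_interval_chain) (use connected_cell consecutive_cells_meet in auto)

text \<open>
  The two intervals are joined by the common point of the last and the first cell; either of them
  may be empty.
\<close>

lemma connected_outer_cells:
  assumes "a < n" "1 < b"
  shows "connected (\<Union>k\<in>{1..a} \<union> {b..n}. cell k)"
proof (cases "a = 0 \<or> n < b")
  case True
  then have "{1..a} \<union> {b..n} = {1..a} \<or> {1..a} \<union> {b..n} = {b..n}" by auto
  then show ?thesis using connected_cell_interval[of 1 a] connected_cell_interval[of b n] assms
    by (elim disjE) auto
next
  case False
  have "(\<Union>k\<in>{1..a}. cell k) \<inter> (\<Union>k\<in>{b..n}. cell k) \<noteq> {}"
  proof -
    obtain x where "x \<in> cell n" "x \<in> cell 1" using last_first_meet by blast
    moreover have "1 \<in> {1..a}" "n \<in> {b..n}" using False by auto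
    ultimately show ?thesis by blast
  qed
  then show ?thesis
    unfolding UN_Un using assms
    by (intro connected_Un connected_cell_interval) auto
qed

lemma connected_minus_cell:
  assumes "l \<in> {1..n}"
  shows "connected (\<Union>j\<in>{1..n} - {l}. cell j)"
proof -
  have "{1..n} - {l} = {1..l-1} \<union> {Suc l..n}" using assms by auto
  moreover have "connected (\<Union>j\<in>{1..l-1} \<union> {Suc l..n}. cell j)"
    by (rule connected_outer_cells) (use assms in auto)
  ultimately show ?thesis by simp
qed

lemma connected_minus_adjacent_cells:
  assumes "i \<in> {1..n}" "j \<in> {1..n}" "i \<noteq> j" "adjacent i j"
  shows "connected (\<Union>k\<in>{1..n} - {i, j}. cell k)"
proof -
  have ordered: "connected (\<Union>k\<in>{1..n} - {i, j}. cell k)"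
    if ij: "i \<in> {1..n}" "j \<in> {1..n}" "i < j" "adjacent i j" for i j
  proof -
    from ij consider "j = Suc i" | "i = 1" "j = n"
      unfolding adjacent_def by force
    then show ?thesis
    proof cases
      case 1
      have "{1..n} - {i, j} = {1..i-1} \<union> {Suc j..n}" using ij 1 by auto
      moreover have "connected (\<Union>k\<in>{1..i-1} \<union> {Suc j..n}. cell k)"
        by (rule connected_outer_cells) (use ij in auto)
      ultimately show ?thesis by simp
    next
      case 2
      have "{1..n} - {i, j} = {2..n-1}" using 2 by auto
      moreover have "connected (\<Union>k\<in>{2..n-1}. cell k)"
        by (rule connected_cell_interval) auto
      ultimately show ?thesis by simp
    qed
  qed
  show ?thesis
  proof (cases "i < j")
    case True
    then show ?thesis using ordered assms by blast
  next
    case False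
    moreover have "adjacent j i" using assms(4) unfolding adjacent_def by linarith
    ultimately show ?thesis using ordered[of j i] assms by (simp add: insert_commute)
  qed
qed

text \<open>The finitely many other cells form a closed set, and off this set a cell is open in \<open>F\<close>.\<close>

lemma frontier_of_cell:
  assumes "k \<in> {1..n}" "x \<in> top_of_set F frontier_of cell k"
  shows "\<exists>j\<in>{1..n}. j \<noteq> k \<and> x \<in> cell k \<inter> cell j"
proof -
  have sub: "cell k \<subseteq> F" using cell_subset assms by blast
  have "closedin (top_of_set F) (cell k)"
    using closed_cell[OF assms(1)] sub by (simp add: closed_subset)
  then have xk: "x \<in> cell k"
    using assms(2) frontier_of_subset_closedin by blast
  moreover have "x \<in> (\<Union>j\<in>{1..n} - {k}. cell j)"
  proof (rule ccontr)
    let ?R = "\<Union>j\<in>{1..n} - {k}. cell j"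
    assume "x \<notin> ?R"
    have "closed ?R" using closed_cell by auto
    then have "openin (top_of_set F) (F - ?R)"
      by (metis Diff_Diff_Int Diff_eq open_Compl openin_open_Int)
    moreover have "F - ?R \<subseteq> cell k" using in_some_cell by blast
    ultimately have "x \<in> top_of_set F interior_of cell k"
      using \<open>x \<notin> ?R\<close> xk sub unfolding interior_of_def by blast
    then show False using assms(2) unfolding frontier_of_def by blast
  qed
  ultimately show ?thesis by blast
qed

section \<open>Counting the copies through a point\<close>

lemma finite_level_copies: "finite (level_copies n f F m)"
  unfolding level_copies_def by (simp add: finite_lists_length_eq)

lemma level_copies_Suc:
  "level_copies n f F (Suc m) = (\<Union>k\<in>{1..n}. (`) (f k) ` level_copies n f F m)"
proof -
  have "{\<sigma>. set \<sigma> \<subseteq> {1..n} \<and> length \<sigma> = Suc m} =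
    (\<Union>k\<in>{1..n}. (#) k ` {\<sigma>. set \<sigma> \<subseteq> {1..n} \<and> length \<sigma> = m})"
    by (auto simp: length_Suc_conv)
  moreover have "copy f F (k # \<sigma>) = f k ` copy f F \<sigma>" for k \<sigma>
    by (simp add: copy_def word_map_Cons image_comp)
  ultimately show ?thesis
    unfolding level_copies_def by (simp add: image_UN image_image)
qed

lemma level_copies_image:
  "k \<in> {1..n} \<Longrightarrow> C \<in> level_copies n f F m \<Longrightarrow> f k ` C \<in> level_copies n f F (Suc m)"
  unfolding level_copies_Suc by blast

lemma level_copies_0: "level_copies n f F 0 = {F}"
  unfolding level_copies_def copy_def by (auto simp: word_map_Nil)

lemma level_copy_subset: "C \<in> level_copies n f F m \<Longrightarrow> C \<subseteq> F"
proof (induction m arbitrary: C)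
  case (Suc m)
  then obtain k C' where "k \<in> {1..n}" "C' \<in> level_copies n f F m" "C = f k ` C'"
    unfolding level_copies_Suc by blast
  then show ?case using Suc.IH[of C'] cell_subset[of k] by blast
qed (simp add: level_copies_0)

lemma level_copies_cover: "x \<in> F \<Longrightarrow> \<exists>C\<in>level_copies n f F m. x \<in> C"
proof (induction m arbitrary: x)
  case (Suc m)
  obtain k w where "k \<in> {1..n}" "w \<in> F" "x = f k w"
    using in_some_cell[OF Suc.prems] by blast
  then show ?case using Suc.IH[of w] unfolding level_copies_Suc by blast
qed (simp add: level_copies_0)

text \<open>
  Two copies in different cells share at most one point, so knowing that copies have two points
  allows different words to be told apart by the sets they define.
\<close>

lemma level_copy_nontrivial:
  assumes "p \<in> F" "q \<in> F" "p \<noteq> q" "C \<in> level_copies n f F m"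
  shows "\<exists>a\<in>C. \<exists>b\<in>C. a \<noteq> b"
  using assms(4)
proof (induction m arbitrary: C)
  case 0
  then show ?case using assms by (auto simp: level_copies_0)
next
  case (Suc m)
  then obtain k C' where k: "k \<in> {1..n}" "C' \<in> level_copies n f F m" "C = f k ` C'"
    unfolding level_copies_Suc by blast
  with Suc.IH[of C'] obtain a b where "a \<in> C'" "b \<in> C'" "a \<noteq> b" by blast
  then show ?case using k inj_f[OF k(1)] by (metis imageI injD)
qed

lemma copies_through_image:
  assumes "k \<in> {1..n}"
  shows "(`) (f k) ` {C \<in> level_copies n f F m. x \<in> C}
     \<subseteq> {C \<in> level_copies n f F (Suc m). f k x \<in> C}"
  using level_copies_image[OF assms] by auto

lemma card_copies_through_image:
  assumes "k \<in> {1..n}"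
  shows "card ((`) (f k) ` {C \<in> level_copies n f F m. x \<in> C}) = num_copies_at n f F m x"
  unfolding num_copies_at_def
  by (rule card_image) (simp add: inj_on_def inj_image_eq_iff[OF inj_f[OF assms]])

lemma num_copies_at_image:
  assumes "k \<in> {1..n}"
  shows "num_copies_at n f F m x \<le> num_copies_at n f F (Suc m) (f k x)"
proof -
  have "finite {C \<in> level_copies n f F (Suc m). f k x \<in> C}"
    using finite_level_copies by simp
  from card_mono[OF this copies_through_image[OF assms]] show ?thesis
    unfolding card_copies_through_image[OF assms] by (simp add: num_copies_at_def)
qed

text \<open>
  A second cell through \<open>f k x\<close> provides a copy of the next level through \<open>f k x\<close> that is not
  contained in the cell \<open>k\<close>.
\<close>

lemma num_copies_at_node:
  assumes "p \<in> F" "q \<in> F" "p \<noteq> q" and k: "k \<in> {1..n}" and "node (f k x)"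
  shows "num_copies_at n f F m x < num_copies_at n f F (Suc m) (f k x)"
proof -
  let ?z = "f k x"
  let ?X = "(`) (f k) ` {C \<in> level_copies n f F m. x \<in> C}"
  let ?Y = "{C \<in> level_copies n f F (Suc m). ?z \<in> C}"
  obtain j where j: "j \<in> {1..n}" "j \<noteq> k" "?z \<in> cell j"
    using assms(5) unfolding node_def by metis
  then obtain w where w: "w \<in> F" "?z = f j w" by blast
  obtain C where C: "C \<in> level_copies n f F m" "w \<in> C"
    using level_copies_cover[OF w(1)] by blast
  have "f j ` C \<in> ?Y"
    using level_copies_image[OF j(1) C(1)] C(2) w(2) by auto
  moreover have "f j ` C \<notin> ?X"
  proof
    assume "f j ` C \<in> ?X"
    then obtain C' where "C' \<in> level_copies n f F m" "f j ` C = f k ` C'" by blast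
    then have both: "f j ` C \<subseteq> cell j \<inter> cell k"
      using level_copy_subset C(1) by (metis image_mono le_inf_iff)
    obtain a b where ab: "a \<in> C" "b \<in> C" "a \<noteq> b"
      using level_copy_nontrivial[OF assms(1-3) C(1)] by blast
    then have "f j a = f j b"
      using both j(2) by (intro meeting_point_unique[OF j(1) k]) auto
    then show False using ab inj_f[OF j(1)] by (simp add: inj_eq)
  qed
  ultimately have "?X \<subset> ?Y"
    using copies_through_image[OF k, of m x] by blast
  then have "card ?X < card ?Y"
    by (intro psubset_card_mono) (simp_all add: finite_level_copies)
  then show ?thesis
    unfolding card_copies_through_image[OF k] by (simp add: num_copies_at_def)
qed

end

section \<open>Consequences of stability\<close>

locale stable_fractal_necklace = fractal_necklace +
  assumes stable: "stable_necklace n f F"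
begin

text \<open>
  Stability in the form used below, in the coordinates of the cell \<open>k\<close>: \<open>f k p\<close> and \<open>f k q\<close> are points
  where the cell \<open>k\<close> touches other cells. They may coincide.
\<close>

lemma two_cells_on_boundary:
  assumes "k \<in> {1..n}"
  obtains i j p q where "i \<in> {1..n}" "j \<in> {1..n}" "i \<noteq> j" "p \<in> cell i" "q \<in> cell j"
    "\<exists>l\<in>{1..n}. l \<noteq> k \<and> f k p \<in> cell l" "\<exists>l\<in>{1..n}. l \<noteq> k \<and> f k q \<in> cell l"
    "cell i \<noteq> cell j"
proof -
  let ?S = "{copy f F [k, j] | j. j \<in> {1..n} \<and>
               copy f F [k, j] \<inter> (top_of_set F frontier_of copy f F [k]) \<noteq> {}}"
  have copies: "copy f F [k] = cell k" "copy f F [k, j] = f k ` cell j" for j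
    by (auto simp: copy_def word_map_Cons word_map_Nil image_comp)
  have "2 \<le> card ?S" using stable assms unfolding stable_necklace_def by blast
  then obtain C C' where C: "C \<in> ?S" "C' \<in> ?S" "C \<noteq> C'"
    by (metis (no_types, lifting) card_le_Suc0_iff_eq card.infinite not_less_eq_eq
        numeral_2_eq_2 le_zero_eq nat.distinct(1))
  obtain i where i: "i \<in> {1..n}" "C = f k ` cell i" "f k ` cell i \<inter> (top_of_set F frontier_of cell k) \<noteq> {}"
    using C(1) unfolding copies by blast
  obtain j where j: "j \<in> {1..n}" "C' = f k ` cell j" "f k ` cell j \<inter> (top_of_set F frontier_of cell k) \<noteq> {}"
    using C(2) unfolding copies by blast
  obtain p where "p \<in> cell i" "f k p \<in> top_of_set F frontier_of cell k" using i by blast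
  moreover obtain q where "q \<in> cell j" "f k q \<in> top_of_set F frontier_of cell k" using j by blast
  moreover have "cell i \<noteq> cell j" using i j C(3) by blast
  ultimately show ?thesis
    using that[of i j p q] i j frontier_of_cell[OF assms] by blast
qed

lemma F_nontrivial: obtains p q where "p \<in> F" "q \<in> F" "p \<noteq> q"
proof -
  have "1 \<in> {1..n}" using n_ge_3 by auto
  then obtain i j where "i \<in> {1..n}" "j \<in> {1..n}" "cell i \<noteq> cell j"
    using two_cells_on_boundary by metis
  then have "\<not> (\<exists>p. F = {p})" using cell_subset[of i] cell_subset[of j] F_nonempty by fastforce
  then show ?thesis using that F_nonempty by blast
qed

text \<open>
  Three cells are pairwise adjacent only for \<open>n = 3\<close>, and then a point \<open>x\<close> common to them is the only
  point in which any two cells meet. Stability places the preimage of \<open>x\<close> under each \<open>f k\<close> in two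
  cells, so this preimage is \<open>x\<close> again. All maps then fix \<open>x\<close>, and by contraction \<open>F\<close> is the
  single point \<open>x\<close>, which stability forbids.
\<close>

lemma no_triple_point:
  assumes ijl: "i \<in> {1..n}" "j \<in> {1..n}" "l \<in> {1..n}" "i \<noteq> j" "j \<noteq> l" "i \<noteq> l"
    and x: "x \<in> cell i" "x \<in> cell j" "x \<in> cell l"
  shows False
proof -
  have "adjacent i j" "adjacent j l" "adjacent i l"
    using meeting_cells_adjacent[of i j] meeting_cells_adjacent[of j l]
      meeting_cells_adjacent[of i l] ijl x by auto
  then have "n = 3"
    using ijl n_ge_3 unfolding adjacent_def by (auto simp: abs_if split: if_splits)
  then have "{i, j, l} = {1..n}"
    using ijl by (intro card_seteq) auto
  then have all: "x \<in> cell k" if "k \<in> {1..n}" for k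
    using x that unfolding \<open>{i, j, l} = {1..n}\<close>[symmetric] by auto
  have fixed: "f k x = x" if k: "k \<in> {1..n}" for k
  proof -
    obtain i j p q where ij: "i \<in> {1..n}" "j \<in> {1..n}" "i \<noteq> j" "p \<in> cell i" "q \<in> cell j"
      "\<exists>l\<in>{1..n}. l \<noteq> k \<and> f k p \<in> cell l" "\<exists>l\<in>{1..n}. l \<noteq> k \<and> f k q \<in> cell l"
      using two_cells_on_boundary[OF k] by metis
    have only: "f k r = x" if "r \<in> F" "\<exists>l\<in>{1..n}. l \<noteq> k \<and> f k r \<in> cell l" for r
      using that meeting_point_unique all k by (metis imageI)
    have "p \<in> F" "q \<in> F" using ij cell_subset by blast+
    then have "f k p = x" "f k q = x" using only ij by blast+
    then have "p = q" using inj_f[OF k] by (metis injD)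
    then have "p = x" using ij all meeting_point_unique by metis
    then show ?thesis using \<open>f k p = x\<close> by simp
  qed
  obtain c where c: "0 < c" "c < 1"
    and lip: "\<And>k x y. k \<in> {1..n} \<Longrightarrow> dist (f k x) (f k y) \<le> c * dist x y"
    using common_contraction by blast
  \<comment> \<open>A point of \<open>F\<close> farthest from \<open>x\<close> is the image of a point that is no farther from \<open>x\<close>.\<close>
  have "continuous_on F (\<lambda>y. dist x y)" by (intro continuous_intros)
  then obtain y where y: "y \<in> F" "\<And>w. w \<in> F \<Longrightarrow> dist x w \<le> dist x y"
    using continuous_attains_sup[OF compact_F F_nonempty] by blast
  obtain k w where kw: "k \<in> {1..n}" "w \<in> F" "y = f k w" using in_some_cell[OF y(1)] by blast
  have "dist x y \<le> c * dist x w" using lip[OF kw(1), of x w] fixed[OF kw(1)] kw by simp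
  also have "\<dots> \<le> c * dist x y" using y(2)[OF kw(2)] c by (simp add: mult_left_mono)
  finally have "(1 - c) * dist x y \<le> 0" by (simp add: algebra_simps)
  then have "dist x y \<le> 0" using c by (simp add: mult_le_0_iff)
  then have "w = x" if "w \<in> F" for w using y(2)[OF that] by simp
  then show False using F_nontrivial by metis
qed

section \<open>Pulling back a separation at a cut point\<close>

text \<open>
  This marks \<open>U\<close> as the side that absorbs all cells avoiding a point \<open>x\<close> that is not a node: these
  cells form a connected set, so they lie in \<open>U\<close> as soon as one of them meets it.
\<close>

definition anchored :: "'a \<Rightarrow> 'a set \<Rightarrow> bool" where
  "anchored x U \<longleftrightarrow> (\<exists>j\<in>{1..n}. x \<notin> cell j \<and> cell j \<inter> U \<noteq> {})"

text \<open>
  The assumption on boundary points of the cell \<open>k\<close> passes from one scale to the next through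
  stability: two such points have preimages in different cells, and one of these cells avoids \<open>x\<close>.
\<close>

lemma separation_pullback:
  assumes sep: "separation (F - {f k x}) U V" and k: "k \<in> {1..n}"
    and meets: "cell k \<inter> V - {f k x} \<noteq> {}"
    and r: "j \<in> {1..n}" "j \<noteq> k" "r \<in> cell k \<inter> cell j" "r \<noteq> f k x"
    and boundary: "\<And>j p. \<lbrakk>j \<in> {1..n}; j \<noteq> k; p \<in> cell k \<inter> cell j; p \<noteq> f k x\<rbrakk> \<Longrightarrow> p \<in> U"
  shows "separation (F - {x}) (f k -` U) (f k -` V)"
    and "\<not> node x \<Longrightarrow> anchored x (f k -` U)"
proof -
  have inj: "f k a = f k b \<longleftrightarrow> a = b" for a b using inj_f[OF k] by (simp add: inj_eq)
  have img: "f k a \<in> F - {f k x}" if "a \<in> F - {x}" for a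
    using that cell_subset[OF k] inj by auto
  have "f k ` (F - {x}) \<inter> U \<noteq> {}" using r boundary by blast
  moreover have "f k ` (F - {x}) \<inter> V \<noteq> {}" using meets by blast
  moreover have "f k ` (F - {x}) \<subseteq> F - {f k x}" by (rule image_subsetI) (rule img)
  ultimately show "separation (F - {x}) (f k -` U) (f k -` V)"
    by (intro separation_vimage[OF sep continuous_f[OF k]])
  assume "\<not> node x"
  obtain i j p q where ij: "i \<in> {1..n}" "j \<in> {1..n}" "i \<noteq> j" "p \<in> cell i" "q \<in> cell j"
    "\<exists>l\<in>{1..n}. l \<noteq> k \<and> f k p \<in> cell l" "\<exists>l\<in>{1..n}. l \<noteq> k \<and> f k q \<in> cell l"
    using two_cells_on_boundary[OF k] by metis
  have good: "anchored x (f k -` U)"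
    if "x \<notin> cell i" "i \<in> {1..n}" "p \<in> cell i" "\<exists>l\<in>{1..n}. l \<noteq> k \<and> f k p \<in> cell l" for i p
  proof -
    have "p \<noteq> x" "p \<in> F" using that cell_subset by blast+
    then have "f k p \<in> U" using that boundary inj by blast
    then show ?thesis using that unfolding anchored_def by blast
  qed
  from \<open>\<not> node x\<close> ij have "x \<notin> cell i \<or> x \<notin> cell j" unfolding node_def by blast
  then show "anchored x (f k -` U)" using good ij by blast
qed

text \<open>All cells but the one containing \<open>x\<close> lie in \<open>U\<close>, hence so do the boundary points of that cell.\<close>

lemma non_node_step:
  assumes sep: "separation (F - {x}) U V" and "x \<in> F" "\<not> node x" "anchored x U"
  obtains k x' where "k \<in> {1..n}" "x' \<in> F" "f k x' = x"
    "(F - {x}) \<inter> V \<subseteq> cell k"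
    "separation (F - {x'}) (f k -` U) (f k -` V)"
    "\<not> node x' \<Longrightarrow> anchored x' (f k -` U)"
proof -
  obtain k where k: "k \<in> {1..n}" "x \<in> cell k" using in_some_cell[OF \<open>x \<in> F\<close>] by blast
  then obtain x' where x': "x' \<in> F" "f k x' = x" by blast
  let ?R = "\<Union>j\<in>{1..n} - {k}. cell j"
  have xR: "x \<notin> cell j" if "j \<in> {1..n}" "j \<noteq> k" for j
    using \<open>\<not> node x\<close> that k unfolding node_def by blast
  then have "?R \<subseteq> F - {x}" using cell_subset by blast
  moreover have "?R \<inter> U \<noteq> {}" using \<open>anchored x U\<close> k(2) unfolding anchored_def by blast
  ultimately have R: "?R \<subseteq> U" "?R \<inter> V = {}"
    using connected_within_separation[OF sep connected_minus_cell[OF k(1)]] by simp_all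
  have Vk: "(F - {x}) \<inter> V \<subseteq> cell k"
  proof
    fix v assume v: "v \<in> (F - {x}) \<inter> V"
    then obtain j where "j \<in> {1..n}" "v \<in> cell j" using in_some_cell by blast
    then show "v \<in> cell k" using v R(2) by blast
  qed
  have meets: "cell k \<inter> V - {x} \<noteq> {}"
  proof -
    obtain v where v: "v \<in> V" "v \<in> F - {x}"
      using sep unfolding separation_def by (meson disjoint_iff)
    then have "v \<in> cell k" using Vk by (meson IntI subsetD)
    then show ?thesis using v by (metis DiffD2 DiffI IntI empty_iff)
  qed
  obtain j where j: "j \<in> {1..n}" "j \<noteq> k" "cell k \<inter> cell j \<noteq> {}"
    by (rule neighbour_avoiding[OF k(1)])
  then obtain r where jr: "j \<in> {1..n}" "j \<noteq> k" "r \<in> cell k \<inter> cell j"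
    by (metis ex_in_conv)
  have "r \<noteq> x" using xR[OF jr(1,2)] jr(3) by (metis IntD2)
  have boundary: "p \<in> U" if "h \<in> {1..n}" "h \<noteq> k" "p \<in> cell k \<inter> cell h" for h p
    using R(1) that by blast
  have "separation (F - {x'}) (f k -` U) (f k -` V)" "\<not> node x' \<Longrightarrow> anchored x' (f k -` U)"
    using separation_pullback[of k x' U V j r] sep k(1) x' meets jr \<open>r \<noteq> x\<close> boundary by simp_all
  then show ?thesis using that[OF k(1) x' Vk] by simp
qed

lemma cut_point_non_node_anchored:
  assumes "cut_point F x" "\<not> node x"
  obtains U V where "separation (F - {x}) U V" "anchored x U"
proof -
  obtain U V where sep: "separation (F - {x}) U V"
    using assms unfolding cut_point_def not_connected_iff_separation by blast
  obtain k where k: "k \<in> {1..n}" "x \<in> cell k"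
    using assms in_some_cell unfolding cut_point_def by blast
  obtain j where j: "j \<in> {1..n}" "j \<noteq> k" using neighbour_avoiding[OF k(1)] by blast
  then have "x \<notin> cell j" using k assms(2) unfolding node_def by blast
  moreover obtain y where "y \<in> cell j" using F_nonempty by blast
  moreover from calculation have "y \<in> U \<union> V"
    using sep cell_subset[OF j(1)] unfolding separation_def by blast
  ultimately have "anchored x U \<or> anchored x V" using j unfolding anchored_def by blast
  then show ?thesis using that sep separation_commute by blast
qed

text \<open>
  The cells off the node lie on one side, and the other side meets at least one of the two cells
  through the node. That cell meets the first side as well, in its other neighbour, and its only
  boundary point outside the first side can be the node itself. So the separation can be
  restricted to that cell.
\<close>

lemma node_step:
  assumes "cut_point F x" "node x"
  obtains k x' U V where "k \<in> {1..n}" "x' \<in> F" "f k x' = x"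
    "separation (F - {x'}) U V" "\<not> node x' \<Longrightarrow> anchored x' U"
proof -
  obtain i j where ij: "i \<in> {1..n}" "j \<in> {1..n}" "i \<noteq> j" "x \<in> cell i" "x \<in> cell j"
    using assms(2) unfolding node_def by blast
  let ?R = "\<Union>k\<in>{1..n} - {i, j}. cell k"
  have xR: "x \<notin> ?R" using no_triple_point ij by blast
  have conn: "connected ?R"
    using connected_minus_adjacent_cells meeting_cells_adjacent ij by blast
  have "?R \<subseteq> F - {x}" using xR cell_subset by blast
  obtain U0 V0 where sep0: "separation (F - {x}) U0 V0"
    using assms unfolding cut_point_def not_connected_iff_separation by blast
  obtain U V where sep: "separation (F - {x}) U V" and R: "?R \<subseteq> U" "?R \<inter> V = {}"
  proof (cases "?R \<inter> U0 = {}")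
    case True
    have cover: "F - {x} \<subseteq> U0 \<union> V0" using sep0 unfolding separation_def by simp
    have "?R \<subseteq> V0"
    proof
      fix y assume y: "y \<in> ?R"
      then have "y \<in> U0 \<union> V0" using \<open>?R \<subseteq> F - {x}\<close> cover by (meson subsetD)
      moreover have "y \<notin> U0" using True y by (meson disjoint_iff)
      ultimately show "y \<in> V0" by simp
    qed
    then show ?thesis using that[OF separation_commute[OF sep0]] True by simp
  next
    case False
    then show ?thesis
      using that[OF sep0] connected_within_separation[OF sep0 conn \<open>?R \<subseteq> F - {x}\<close>] by simp
  qed
  obtain v where "v \<in> V" "v \<in> F - {x}"
    using sep unfolding separation_def by (meson disjoint_iff)
  then have v: "v \<in> V" "v \<in> F" "v \<noteq> x" by simp_all
  obtain k where kv: "k \<in> {1..n}" "v \<in> cell k" using in_some_cell[OF v(2)] by (rule bexE)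
  have "v \<notin> ?R" using R(2) v(1) by (meson disjoint_iff)
  have "k = i \<or> k = j"
  proof (rule ccontr)
    assume "\<not> (k = i \<or> k = j)"
    then have "k \<in> {1..n} - {i, j}" using kv(1) by simp
    then show False using \<open>v \<notin> ?R\<close> kv(2) by (meson UN_I)
  qed
  then obtain l where l: "k = i \<and> l = j \<or> k = j \<and> l = i" by blast
  then have kl: "{k, l} = {i, j}" by (elim disjE conjE) (simp_all add: insert_commute)
  then have kl': "k \<in> {1..n}" "l \<in> {1..n}" "k \<noteq> l" "x \<in> cell k" "x \<in> cell l"
    using ij l by (elim disjE conjE; simp)+
  obtain x' where x': "x' \<in> F" "f k x' = x" using kl'(4) by (metis imageE)
  have meets: "cell k \<inter> V - {x} \<noteq> {}" using v kv(2) by (metis DiffI IntI empty_iff singletonD)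
  obtain m where m: "m \<in> {1..n}" "m \<noteq> k" "m \<noteq> l" "cell k \<inter> cell m \<noteq> {}"
    by (rule neighbour_avoiding[OF kl'(1), of l])
  then obtain r where mr: "m \<in> {1..n}" "m \<noteq> k" "m \<noteq> l" "r \<in> cell k \<inter> cell m"
    by (metis ex_in_conv)
  have "r \<noteq> x" using no_triple_point[of k m l x] kl' mr by blast
  have boundary: "p \<in> U" if h: "h \<in> {1..n}" "h \<noteq> k" "p \<in> cell k \<inter> cell h" "p \<noteq> x" for h p
  proof -
    have "h \<noteq> l" using h kl' meeting_point_unique[of k l p x] by blast
    then have "h \<in> {1..n} - {i, j}" using h(1,2) unfolding kl[symmetric] by simp
    then have "p \<in> ?R" using h(3) by (meson IntD2 UN_I)
    then show ?thesis using R(1) by (rule subsetD[rotated])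
  qed
  have "separation (F - {x'}) (f k -` U) (f k -` V)" "\<not> node x' \<Longrightarrow> anchored x' (f k -` U)"
    using separation_pullback[of k x' U V m r] sep kl'(1) x' meets mr \<open>r \<noteq> x\<close> boundary
    by simp_all
  then show ?thesis using that[OF kl'(1) x'] by simp
qed

section \<open>Absence of cut points\<close>

text \<open>
  Each step down confines \<open>V\<close> to one cell and keeps the pulled back point in \<open>H\<close>, so \<open>V\<close> lies in
  copies of \<open>F\<close> through \<open>x\<close> of every level and can only contain points at distance \<open>0\<close> from \<open>x\<close>.
\<close>

lemma no_persistent_non_node_cut:
  assumes non_node: "\<And>x. x \<in> H \<Longrightarrow> \<not> node x"
    and closed: "\<And>x k. \<lbrakk>f k x \<in> H; k \<in> {1..n}; cut_point F x\<rbrakk> \<Longrightarrow> x \<in> H"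
    and start: "x \<in> H" "x \<in> F" "separation (F - {x}) U V" "anchored x U"
  shows False
proof -
  obtain c where c: "0 < c" "c < 1"
    and lip: "\<And>k x y. k \<in> {1..n} \<Longrightarrow> dist (f k x) (f k y) \<le> c * dist x y"
    using common_contraction by blast
  define D where "D = diameter F"
  have shrink: "dist b x \<le> c ^ m * D"
    if "x \<in> H" "x \<in> F" "separation (F - {x}) U V" "anchored x U" "b \<in> (F - {x}) \<inter> V"
    for x U V b m
    using that
  proof (induction m arbitrary: x U V b)
    case 0
    then show ?case unfolding D_def
      using compact_F by (simp add: diameter_bounded_bound compact_imp_bounded)
  next
    case (Suc m)
    obtain k x' where k: "k \<in> {1..n}" "x' \<in> F" "f k x' = x"
      and V: "(F - {x}) \<inter> V \<subseteq> cell k"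
      and sep: "separation (F - {x'}) (f k -` U) (f k -` V)"
      and anch: "\<not> node x' \<Longrightarrow> anchored x' (f k -` U)"
      using non_node_step[OF Suc.prems(3,2) non_node[OF Suc.prems(1)] Suc.prems(4)] by metis
    have "cut_point F x'"
      using cut_point_if_separation[OF k(2) sep] .
    then have H: "x' \<in> H" using closed[of k x'] k Suc.prems(1) by simp
    have "b \<in> cell k" using V Suc.prems(5) by (rule subsetD)
    then obtain b' where b': "b' \<in> F" "b = f k b'" by (metis imageE)
    then have "b' \<in> (F - {x'}) \<inter> f k -` V" using Suc.prems(5) k by auto
    then have "dist b' x' \<le> c ^ m * D"
      using Suc.IH[OF H k(2) sep anch[OF non_node[OF H]]] by blast
    then have "c * dist b' x' \<le> c ^ Suc m * D"
      using c by (simp add: mult.assoc)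
    then show ?case using lip[OF k(1), of b' x'] k b' by simp
  qed
  obtain b where b: "b \<in> (F - {x}) \<inter> V"
    using start(3) unfolding separation_def by blast
  then have "dist b x \<le> 0"
    using contraction_powers_vanish[OF c] shrink[OF start] by blast
  then show False using b by simp
qed

text \<open>
  The set \<open>H\<close> for the previous lemma consists of all cut points when none of them is a node.
  Otherwise it consists of the cut points with ramification bound \<open>B - 1\<close>, where \<open>B\<close> is the least
  bound of a cut point that is a node; minimality excludes nodes from \<open>H\<close>.
\<close>

theorem no_cut_points:
  assumes ram: "bounded_ramification n f F"
  shows "\<not> cut_point F x"
proof
  assume cut: "cut_point F x"
  define bnd where "bnd B y \<longleftrightarrow> (\<forall>m\<ge>1. num_copies_at n f F m y \<le> B)" for B y
  obtain p q where pq: "p \<in> F" "q \<in> F" "p \<noteq> q" using F_nontrivial by blast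
  show False
  proof (cases "\<exists>z. cut_point F z \<and> node z")
    case False
    then have nn: "\<not> node y" if "cut_point F y" for y using that by blast
    obtain U V where UV: "separation (F - {x}) U V" "anchored x U"
      using cut_point_non_node_anchored[OF cut nn[OF cut]] by blast
    show False
      by (rule no_persistent_non_node_cut[of "{y. cut_point F y}" x U V])
         (use nn cut UV in \<open>auto simp: cut_point_def\<close>)
  next
    case True
    then obtain z0 where z0: "cut_point F z0" "node z0" by blast
    then have "\<exists>B. bnd B z0"
      using ram node_is_main_node[OF z0(2)] unfolding bounded_ramification_def bnd_def by metis
    then have ex: "\<exists>B z. cut_point F z \<and> node z \<and> bnd B z" using z0 by blast
    define B where "B = (LEAST B. \<exists>z. cut_point F z \<and> node z \<and> bnd B z)"
    obtain z where z: "cut_point F z" "node z" "bnd B z"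
      using LeastI_ex[OF ex] unfolding B_def by blast
    obtain k x' U V where k: "k \<in> {1..n}" "x' \<in> F" "f k x' = z"
      and sep: "separation (F - {x'}) U V" and anch: "\<not> node x' \<Longrightarrow> anchored x' U"
      using node_step[OF z(1,2)] by metis
    \<comment> \<open>Below the node the count is smaller by at least one, so this cut point belongs to \<open>H\<close>.\<close>
    have less: "num_copies_at n f F m x' < B" if "1 \<le> m" for m
    proof -
      have "num_copies_at n f F m x' < num_copies_at n f F (Suc m) z"
        using num_copies_at_node[OF pq k(1), of x' m] z(2) k(3) by simp
      also have "\<dots> \<le> B" using z(3) unfolding bnd_def by simp
      finally show ?thesis .
    qed
    from less[of 1] have "B > 0" by simp
    define H where "H = {y. cut_point F y \<and> bnd (B - 1) y}"
    have nn: "\<not> node y" if "y \<in> H" for y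
    proof
      assume "node y"
      then have "\<exists>z. cut_point F z \<and> node z \<and> bnd (B - 1) z"
        using that unfolding H_def by blast
      then have "B \<le> B - 1" by (subst (1) B_def) (rule Least_le)
      then show False using \<open>B > 0\<close> by simp
    qed
    have "num_copies_at n f F m x' \<le> B - 1" if "1 \<le> m" for m
      using less[OF that] by simp
    then have x'H: "x' \<in> H"
      using cut_point_if_separation[OF k(2) sep] unfolding H_def bnd_def by simp
    have closed: "y \<in> H" if y: "f k y \<in> H" "k \<in> {1..n}" "cut_point F y" for k y
    proof -
      have "num_copies_at n f F m y \<le> B - 1" if "1 \<le> m" for m
      proof -
        have "num_copies_at n f F m y \<le> num_copies_at n f F (Suc m) (f k y)"
          by (rule num_copies_at_image[OF y(2)])
        also have "\<dots> \<le> B - 1" using y(1) unfolding H_def bnd_def by simp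
        finally show ?thesis .
      qed
      then show ?thesis using y(3) unfolding H_def bnd_def by simp
    qed
    show False
      by (rule no_persistent_non_node_cut[OF nn closed x'H k(2) sep anch[OF nn[OF x'H]]])
  qed
qed

end

theorem theorem2:
  fixes f :: "nat \<Rightarrow> real ^ 'd \<Rightarrow> real ^ 'd"
    and F :: "(real ^ 'd) set"
    and n :: nat
  assumes "CARD('d) \<ge> 2"
    and "necklace_IFS n f F"
    and "stable_necklace n f F"
    and "bounded_ramification n f F"
  shows "\<not> (\<exists>x. cut_point F x)"
proof -
  interpret stable_fractal_necklace n f F
    by unfold_locales (rule assms)+
  show ?thesis using no_cut_points[OF assms(4)] by blast
qed

end
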